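(* Let $\chi$ be a Banach space, let $n\ge 1$, and let $f,g:\chi\to\mathbb{R}$ be functionals whose Gâteaux differentials of all orders up to $n$ exist, with $g$ nowhere zero. Then for every $y\in\chi$ and all increments $\eta_1,\ldots,\eta_n\in\chi$, writing $\Xi=\{\eta_1,\ldots,\eta_n\}$, $$\delta^n\left(\frac{f(y)}{g(y)};\eta_1,\ldots,\eta_n\right)=\sum_{\Pi\subseteq\Xi}\left(\sum_{\pi\in\mathrm{Part}(\Pi)}\frac{(-1)^{|\pi|}\,|\pi|!}{g(y)^{|\pi|+1}}\prod_{\omega\in\pi}\delta^{|\omega|}g\left(y;\zeta_{\pi,\omega,1},\ldots,\zeta_{\pi,\omega,|\omega|}\right)\right)\delta^{|\Xi|-|\Pi|}f\left(y;\phi_1,\ldots,\phi_{|\Xi|-|\Pi|}\right),$$ where the outer sum is over all subsets $\Pi$ of $\Xi$ (including $\emptyset$ and $\Xi$), the inner sum is over all partitions $\pi$ of $\Pi$, the product is over the blocks $\omega=\{\zeta_{\pi,\omega,1},\ldots,\zeta_{\pi,\omega,|\omega|}\}$ of $\pi$, and $\phi_1,\ldots,\phi_{|\Xi|-|\Pi|}$ are the elements of $\Xi\setminus\Pi$.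
   Context: The Gâteaux differential of a functional $\Psi$ at $\psi$ with increment $\xi$ is $\delta\Psi(\psi;\xi)=\lim_{\epsilon\to 0}\frac{1}{\epsilon}\left(\Psi(\psi+\epsilon\xi)-\Psi(\psi)\right)$. The $n$-th order differential is defined recursively: $\delta^n\Psi(\psi;\xi_1,\ldots,\xi_n)$ is the Gâteaux differential at $\psi$, with increment $\xi_n$, of the functional $\psi\mapsto\delta^{n-1}\Psi(\psi;\xi_1,\ldots,\xi_{n-1})$; the differential of order $0$ is the functional itself, $\delta^0\Psi(\psi)=\Psi(\psi)$. The notation $\delta^n(h(y);\eta_1,\ldots,\eta_n)$ means $\delta^n h(y;\eta_1,\ldots,\eta_n)$. $\mathrm{Part}(S)$ denotes the set of all partitions of a finite set $S$ into nonempty disjoint blocks; the empty set has exactly one partition, the empty one, with $|\pi|=0$ and empty product equal to $1$. Here $|\pi|$ is the number of blocks of $\pi$ and $|\omega|$ the number of elements of $\omega$. Increments are treated as labelled by their indices (so $\eta_i$ and $\eta_j$ with $i\ne j$ count as distinct elements even if equal as vectors), and the elements of each block $\omega$ and of $\Xi\setminus\Pi$ are listed in increasing order of index. *)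

theory Defs
  imports Complex_Main "HOL-Library.Disjoint_Sets"
begin

definition has_gateaux :: "('a::real_normed_vector \<Rightarrow> real) \<Rightarrow> 'a \<Rightarrow> 'a \<Rightarrow> bool" where
  "has_gateaux \<Psi> \<psi> \<xi> \<longleftrightarrow>
     (\<exists>L. ((\<lambda>\<epsilon>::real. 1 / \<epsilon> * (\<Psi> (\<psi> + \<epsilon> *\<^sub>R \<xi>) - \<Psi> \<psi>)) \<longlongrightarrow> L) (at 0))"

text \<open>The value below is meaningful only if \<^term>\<open>has_gateaux \<Psi> \<psi> \<xi>\<close> holds, since
  \<^const>\<open>Lim\<close> is total.\<close>

definition gateaux :: "('a::real_normed_vector \<Rightarrow> real) \<Rightarrow> 'a \<Rightarrow> 'a \<Rightarrow> real" where
  "gateaux \<Psi> \<psi> \<xi> =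
     Lim (at 0) (\<lambda>\<epsilon>::real. 1 / \<epsilon> * (\<Psi> (\<psi> + \<epsilon> *\<^sub>R \<xi>) - \<Psi> \<psi>))"

text \<open>The differential of order \<^term>\<open>length \<xi>s\<close> with increments \<^term>\<open>\<xi>s\<close>. The last
  increment of the list is the one applied last, as \<open>gateaux_diff_snoc\<close> shows. Symmetry in
  the increments is not assumed, so their order matters.\<close>

definition gateaux_diff :: "('a::real_normed_vector \<Rightarrow> real) \<Rightarrow> 'a \<Rightarrow> 'a list \<Rightarrow> real" where
  "gateaux_diff \<Psi> \<psi> \<xi>s = foldl (\<lambda>\<Phi> \<xi> \<phi>. gateaux \<Phi> \<phi> \<xi>) \<Psi> \<xi>s \<psi>"

lemma gateaux_diff_Nil [simp]: "gateaux_diff \<Psi> \<psi> [] = \<Psi> \<psi>"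
  by (simp add: gateaux_diff_def)

lemma gateaux_diff_snoc:
  "gateaux_diff \<Psi> \<psi> (\<xi>s @ [\<xi>]) = gateaux (\<lambda>\<phi>. gateaux_diff \<Psi> \<phi> \<xi>s) \<psi> \<xi>"
  by (simp add: gateaux_diff_def)

text \<open>All differentials of orders \<open>1, \<dots>, n\<close> exist, at every point and for all increments;
  order \<open>k + 1\<close> is the case \<^term>\<open>length \<xi>s = k\<close>.\<close>

definition gateaux_differentiable_upto ::
    "nat \<Rightarrow> ('a::real_normed_vector \<Rightarrow> real) \<Rightarrow> bool" where
  "gateaux_differentiable_upto n \<Psi> \<longleftrightarrow>
     (\<forall>\<xi>s \<psi> \<xi>. length \<xi>s < n \<longrightarrow> has_gateaux (\<lambda>\<phi>. gateaux_diff \<Psi> \<phi> \<xi>s) \<psi> \<xi>)"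

text \<open>Increments are labelled by indices: a set of increments is represented by a finite index
  set, and its members are listed in increasing order of index.\<close>

definition incr_list :: "(nat \<Rightarrow> 'a) \<Rightarrow> nat set \<Rightarrow> 'a list" where
  "incr_list \<eta> S = map \<eta> (sorted_list_of_set S)"

end

theory Submission
  imports Defs
begin

text \<open>
  Everything happens on the line \<open>t \<mapsto> y + t \<xi>\<close>: a Gateaux differential is the ordinary derivative
  at \<open>0\<close> of the restriction to that line, so the one-variable sum, product and chain rules apply.
  The formula then follows by adding one increment \<open>\<eta>\<^sub>a\<close> at a time, with \<open>a\<close> larger than
  all indices treated so far. Since increments are listed by increasing index, \<open>\<eta>\<^sub>a\<close> is then the
  last increment of every list in which it occurs, and adding it to a list is one more
  differentiation.

  The inner sum over \<open>Part(A)\<close> is the differential of \<open>1 / g\<close> along the increments indexed by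
  \<open>A\<close> (Faa di Bruno's formula). Differentiate the summand of a partition \<open>\<pi>\<close> once more, along
  \<open>\<eta>\<^sub>a\<close>. The derivative either falls on the power of \<open>g\<close>, which yields the summand of
  \<open>\<pi>\<close> with the new block \<open>{a}\<close>, or on the factor of one block \<open>\<omega>\<close>, which yields the summand
  of \<open>\<pi>\<close> with \<open>a\<close> put into \<open>\<omega>\<close>. Every partition of \<open>insert a A\<close> arises in exactly one of
  these ways (\<open>sum_partition_on_insert\<close>), so the result is the sum over \<open>Part(insert a A)\<close>
  (\<open>reciprocal_diff_deriv\<close>).

  The outer sum is the Leibniz rule for \<open>(1 / g) \<cdot> f\<close>: by the product rule the new index joins
  either the set \<open>A\<close> of increments given to \<open>1 / g\<close> or its complement, which is given to \<open>f\<close>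
  (\<open>quotient_diff_deriv\<close>). Both the existence of the differentials of \<open>f / g\<close> and their value
  come out of the same induction, because the formula of order \<open>k\<close> holds at every point and is
  itself differentiable as long as \<open>k < n\<close>.
\<close>

section \<open>Partitions of a set with one more element\<close>

lemma partition_on_insert_singleton:
  assumes "a \<notin> A" "partition_on A P"
  shows "partition_on (insert a A) (insert {a} P)"
proof -
  have "disjnt {a} (\<Union>P)"
    using assms partition_onD1[OF assms(2)] by auto
  then show ?thesis
    using assms by (simp add: partition_on_insert)
qed

lemma partition_on_insert_into_block:
  assumes "a \<notin> A" "partition_on A P" "W \<in> P"
  shows "partition_on (insert a A) (insert (insert a W) (P - {W}))"
proof -
  have dj: "disjnt W (\<Union>(P - {W}))"
    using partition_onD2[OF assms(2)] \<open>W \<in> P\<close> by (auto simp: disjnt_def disjoint_def)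
  have "partition_on A (insert W (P - {W}))"
    using assms by (simp add: insert_absorb)
  then have "partition_on (A - W) (P - {W})"
    using dj partition_on_insert by blast
  moreover have "disjnt (insert a W) (\<Union>(P - {W}))"
    using dj assms(1) partition_onD1[OF assms(2)] by auto
  moreover have "insert a A - insert a W = A - W" "W \<subseteq> A"
    using assms partition_onD1[OF assms(2)] by auto
  ultimately show ?thesis
    by (subst partition_on_insert) auto
qed

text \<open>Deleting \<open>a\<close> from a partition of \<open>insert a A\<close> leaves a partition of \<open>A\<close>. What
  has to be remembered to undo this is the block that contained \<open>a\<close>: it was either \<open>{a}\<close>, which
  disappears, or \<open>insert a W\<close> for a block \<open>W\<close> of the remaining partition.\<close>

lemma sum_partition_on_insert:
  fixes F :: "'b set set \<Rightarrow> 'c::comm_monoid_add"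
  assumes fin: "finite A" and a: "a \<notin> A"
  shows "(\<Sum>P | partition_on (insert a A) P. F P) =
    (\<Sum>P | partition_on A P. F (insert {a} P) + (\<Sum>W\<in>P. F (insert (insert a W) (P - {W}))))"
proof -
  let ?S = "{P. partition_on (insert a A) P}"
  let ?T = "Sigma {P. partition_on A P} (\<lambda>P. P)"
  let ?ext = "\<lambda>(P, W). insert (insert a W) (P - {W})"
  \<comment> \<open>The block of \<open>a\<close> with \<open>a\<close> deleted; the union has only one member.\<close>
  let ?rest = "\<lambda>Q. \<Union>{V\<in>Q. a \<in> V} - {a}"
  have finS: "finite ?S"
    using fin by (intro finitely_many_partition_on) auto
  have finT: "\<forall>P\<in>{P. partition_on A P}. finite P"
    using fin finite_elements by auto
  have notin: "a \<notin> V" if "partition_on A P" "V \<in> P" for P V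
    using that a partition_onD1 by fastforce
  have "(\<Sum>P\<in>?S. F P) = (\<Sum>P\<in>{P\<in>?S. {a} \<in> P}. F P) + (\<Sum>P\<in>{P\<in>?S. {a} \<notin> P}. F P)"
    using finS by (subst sum.union_disjoint[symmetric]) (auto intro!: sum.cong)
  also have "(\<Sum>P\<in>{P\<in>?S. {a} \<in> P}. F P) = (\<Sum>P | partition_on A P. F (insert {a} P))"
  proof (rule sum.reindex_bij_witness[where i = "insert {a}" and j = "\<lambda>Q. Q - {{a}}"])
    fix Q assume "Q \<in> {P\<in>?S. {a} \<in> P}"
    then have Q: "partition_on (insert a A) Q" "{a} \<in> Q" by auto
    show "insert {a} (Q - {{a}}) = Q" using Q by auto
    then show "F (insert {a} (Q - {{a}})) = F Q" by simp
    have "a \<notin> V" if "V \<in> Q - {{a}}" for V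
      using that Q(2) pairwiseD[OF partition_onD2[OF Q(1)], of "{a}" V] by auto
    then have "disjnt {a} (\<Union>(Q - {{a}}))"
      by simp
    moreover have "partition_on (insert a A) (insert {a} (Q - {{a}}))"
      using Q by (simp add: insert_absorb)
    ultimately have "partition_on (insert a A - {a}) (Q - {{a}})"
      by (simp only: partition_on_insert)
    then show "Q - {{a}} \<in> {P. partition_on A P}"
      using a by simp
  next
    fix P assume "P \<in> {P. partition_on A P}"
    then have P: "partition_on A P" by simp
    show "insert {a} P - {{a}} = P" using notin[OF P] by auto
    show "insert {a} P \<in> {P\<in>?S. {a} \<in> P}"
      using partition_on_insert_singleton[OF a P] by simp
  qed
  also have "(\<Sum>P\<in>{P\<in>?S. {a} \<notin> P}. F P) = (\<Sum>x\<in>?T. F (?ext x))"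
  proof (rule sum.reindex_bij_witness[where i = ?ext
        and j = "\<lambda>Q. (insert (?rest Q) (Q - {insert a (?rest Q)}), ?rest Q)"])
    fix Q assume "Q \<in> {P\<in>?S. {a} \<notin> P}"
    then have Q: "partition_on (insert a A) Q" "{a} \<notin> Q" by auto
    then obtain V where V: "V \<in> Q" "a \<in> V"
      using partition_onD1 by blast
    have uniq: "U = V" if "U \<in> Q" "a \<in> U" for U
      using that V pairwiseD[OF partition_onD2[OF Q(1)], of U V] by (auto simp: disjnt_iff)
    define W where "W = V - {a}"
    have "{V \<in> Q. a \<in> V} = {V}"
      using V uniq by blast
    then have rest: "?rest Q = W"
      by (simp add: W_def)
    have "V \<noteq> {a}"
      using V(1) Q(2) by metis
    then have VW: "V = insert a W" "a \<notin> W" "W \<noteq> {}"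
      using V(2) by (auto simp: W_def)
    have "W \<notin> Q"
      using pairwiseD[OF partition_onD2[OF Q(1)], of W V] V VW by (auto simp: disjnt_iff)
    then have eq: "?ext (insert W (Q - {V}), W) = Q"
      using V VW by auto
    then show "?ext (insert (?rest Q) (Q - {insert a (?rest Q)}), ?rest Q) = Q"
      unfolding rest VW(1) .
    then show "F (?ext (insert (?rest Q) (Q - {insert a (?rest Q)}), ?rest Q)) = F Q"
      by simp
    have dj: "disjnt V (\<Union>(Q - {V}))"
      using V pairwiseD[OF partition_onD2[OF Q(1)], of V] by auto
    moreover have "partition_on (insert a A) (insert V (Q - {V}))"
      using Q V by (simp add: insert_absorb)
    ultimately have "partition_on (insert a A - V) (Q - {V})" "V \<subseteq> insert a A"
      by (simp_all only: partition_on_insert)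
    moreover have "insert a A - V = A - W" "W \<subseteq> A"
      using a VW \<open>V \<subseteq> insert a A\<close> by auto
    moreover have "disjnt W (\<Union>(Q - {V}))"
      using dj VW by auto
    ultimately have "partition_on A (insert W (Q - {V}))"
      using VW by (subst partition_on_insert) auto
    then show "(insert (?rest Q) (Q - {insert a (?rest Q)}), ?rest Q) \<in> ?T"
      unfolding rest VW(1)[symmetric] by auto
  next
    fix x assume "x \<in> ?T"
    then obtain P W where x: "x = (P, W)" and P: "partition_on A P" and W: "W \<in> P"
      by auto
    have nW: "W \<noteq> {}" "a \<notin> W"
      using partition_onD3[OF P] W notin[OF P] by auto
    have "{V \<in> ?ext x. a \<in> V} = {insert a W}"
      using notin[OF P] by (auto simp: x)
    then have rest: "?rest (?ext x) = W"
      using nW by auto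
    show "(insert (?rest (?ext x)) (?ext x - {insert a (?rest (?ext x))}), ?rest (?ext x)) = x"
      unfolding rest using notin[OF P] W by (auto simp: x)
    show "?ext x \<in> {P\<in>?S. {a} \<notin> P}"
      using partition_on_insert_into_block[OF a P W] notin[OF P] nW by (auto simp: x)
  qed
  also have "(\<Sum>x\<in>?T. F (?ext x)) =
      (\<Sum>P | partition_on A P. \<Sum>W\<in>P. F (insert (insert a W) (P - {W})))"
    using fin finT by (subst sum.Sigma) (auto simp: finitely_many_partition_on intro!: sum.cong)
  finally show ?thesis
    by (simp add: sum.distrib)
qed

section \<open>Gateaux differentials as derivatives along lines\<close>

abbreviation has_line_derivative ::
    "('a::real_normed_vector \<Rightarrow> real) \<Rightarrow> 'a \<Rightarrow> 'a \<Rightarrow> real \<Rightarrow> bool" where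
  "has_line_derivative \<Psi> y \<xi> L \<equiv> ((\<lambda>t. \<Psi> (y + t *\<^sub>R \<xi>)) has_real_derivative L) (at 0)"

lemma has_line_derivative_iff:
  "has_line_derivative \<Psi> y \<xi> L \<longleftrightarrow>
    ((\<lambda>\<epsilon>. 1 / \<epsilon> * (\<Psi> (y + \<epsilon> *\<^sub>R \<xi>) - \<Psi> y)) \<longlongrightarrow> L) (at 0)"
  by (simp add: DERIV_def)

lemma has_gateaux_iff: "has_gateaux \<Psi> y \<xi> \<longleftrightarrow> (\<exists>L. has_line_derivative \<Psi> y \<xi> L)"
  by (simp add: has_gateaux_def has_line_derivative_iff)

lemma gateaux_eqI: "has_line_derivative \<Psi> y \<xi> L \<Longrightarrow> gateaux \<Psi> y \<xi> = L"
  unfolding gateaux_def has_line_derivative_iff by (rule tendsto_Lim) auto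

lemma incr_list_insert_greatest:
  assumes "finite A" "\<forall>b\<in>A. b < a"
  shows "incr_list \<eta> (insert a A) = incr_list \<eta> A @ [\<eta> a]"
proof -
  have "sorted_list_of_set (insert a A) = sorted_list_of_set A @ [a]"
    using assms by (auto simp: sorted_insort_is_snoc less_imp_le)
  then show ?thesis
    by (simp add: incr_list_def)
qed

lemma gateaux_diff_line_derivative:
  assumes "gateaux_differentiable_upto n h" "finite A" "card A < n" "\<forall>b\<in>A. b < a"
  shows "has_line_derivative (\<lambda>x. gateaux_diff h x (incr_list \<eta> A)) y (\<eta> a)
    (gateaux_diff h y (incr_list \<eta> (insert a A)))"
proof -
  have "has_gateaux (\<lambda>x. gateaux_diff h x (incr_list \<eta> A)) y (\<eta> a)"
    using assms by (simp add: gateaux_differentiable_upto_def incr_list_def)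
  then obtain L where L: "has_line_derivative (\<lambda>x. gateaux_diff h x (incr_list \<eta> A)) y (\<eta> a) L"
    by (auto simp: has_gateaux_iff)
  then show ?thesis
    using assms by (simp add: incr_list_insert_greatest gateaux_diff_snoc gateaux_eqI[OF L])
qed

section \<open>Differentials of the reciprocal\<close>

definition partition_term ::
    "(nat \<Rightarrow> 'a::real_normed_vector) \<Rightarrow> ('a \<Rightarrow> real) \<Rightarrow> nat set set \<Rightarrow> 'a \<Rightarrow> real" where
  "partition_term \<eta> g \<pi> y = (-1) ^ card \<pi> * fact (card \<pi>) / g y ^ (card \<pi> + 1) *
     (\<Prod>\<omega>\<in>\<pi>. gateaux_diff g y (incr_list \<eta> \<omega>))"

definition reciprocal_diff ::
    "(nat \<Rightarrow> 'a::real_normed_vector) \<Rightarrow> ('a \<Rightarrow> real) \<Rightarrow> nat set \<Rightarrow> 'a \<Rightarrow> real" where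
  "reciprocal_diff \<eta> g A y = (\<Sum>\<pi> | partition_on A \<pi>. partition_term \<eta> g \<pi> y)"

text \<open>The coefficient of a partition with \<open>m\<close> blocks is the \<open>m\<close>-th derivative
  \<open>(-1)\<^sup>m m! / u\<^sup>m\<^sup>+\<^sup>1\<close> of \<open>u \<mapsto> 1 / u\<close> at \<open>u = g y\<close>. Hence differentiating the coefficient
  produces the coefficient for \<open>m + 1\<close> blocks times the factor of the new block \<open>{a}\<close>, whereas
  enlarging a block keeps \<open>m\<close>.\<close>

lemma partition_term_line_derivative:
  assumes g: "gateaux_differentiable_upto n g" "\<And>x. g x \<noteq> 0"
    and A: "finite A" "card A < n" "\<forall>b\<in>A. b < a"
    and P: "partition_on A P"
  shows "has_line_derivative (partition_term \<eta> g P) y (\<eta> a)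
    (partition_term \<eta> g (insert {a} P) y +
      (\<Sum>W\<in>P. partition_term \<eta> g (insert (insert a W) (P - {W})) y))"
proof -
  let ?D = "\<lambda>W x. gateaux_diff g x (incr_list \<eta> W)"
  let ?m = "card P"
  let ?c = "(-1) ^ ?m * fact ?m :: real"
  have finP: "finite P"
    using A P finite_elements by blast
  have sub: "W \<subseteq> A" if "W \<in> P" for W
    using that P partition_onD1 by blast
  have notin: "insert a W \<notin> P" for W
    using sub A(3) by auto
  have dg: "has_line_derivative g y (\<eta> a) (?D {a} y)"
    using gateaux_diff_line_derivative[OF g(1), where A = "{}" and a = a and \<eta> = \<eta> and y = y] A(2) by (simp add: incr_list_def)
  have dW: "has_line_derivative (?D W) y (\<eta> a) (?D (insert a W) y)" if "W \<in> P" for W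
  proof (rule gateaux_diff_line_derivative[OF g(1)])
    show "finite W" "\<forall>b\<in>W. b < a"
      using sub[OF that] A finite_subset[of W A] by auto
    show "card W < n"
      using card_mono[OF A(1) sub[OF that]] A(2) by simp
  qed
  have dprod: "has_line_derivative (\<lambda>x. \<Prod>W\<in>P. ?D W x) y (\<eta> a)
      (\<Sum>W\<in>P. ?D (insert a W) y * (\<Prod>V\<in>P - {W}. ?D V y))"
    using has_field_derivative_prod[of P "\<lambda>W t. ?D W (y + t *\<^sub>R \<eta> a)", OF dW] by simp
  have dcoeff: "has_line_derivative (\<lambda>x. ?c / g x ^ (?m + 1)) y (\<eta> a)
      ((-1) ^ (?m + 1) * fact (?m + 1) / g y ^ (?m + 2) * ?D {a} y)"
  proof -
    have "has_line_derivative (\<lambda>x. ?c / g x ^ Suc ?m) y (\<eta> a)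
        (- ?c * real (Suc ?m) * ?D {a} y * (g y ^ ?m * inverse ((g y ^ Suc ?m) ^ Suc (Suc 0))))"
      using DERIV_cmult[OF DERIV_inverse_fun[OF DERIV_power[OF dg, of "Suc ?m"]], of ?c] g(2)[of y]
      by (simp add: mult_ac divide_inverse)
    also have "g y ^ ?m * inverse ((g y ^ Suc ?m) ^ Suc (Suc 0)) = 1 / g y ^ (?m + 2)"
      using g(2)[of y] by (simp add: field_simps)
    also have "- ?c * real (Suc ?m) * ?D {a} y * (1 / g y ^ (?m + 2)) =
        (-1) ^ (?m + 1) * fact (?m + 1) / g y ^ (?m + 2) * ?D {a} y"
      by (simp add: mult_ac)
    finally show ?thesis
      by simp
  qed
  have new: "partition_term \<eta> g (insert {a} P) y =
      (-1) ^ (?m + 1) * fact (?m + 1) / g y ^ (?m + 2) * ?D {a} y * (\<Prod>W\<in>P. ?D W y)"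
    using finP notin[of "{}"] by (simp add: partition_term_def)
  have enlarged: "partition_term \<eta> g (insert (insert a W) (P - {W})) y =
      ?c / g y ^ (?m + 1) * (?D (insert a W) y * (\<Prod>V\<in>P - {W}. ?D V y))" if "W \<in> P" for W
  proof -
    have "card (insert (insert a W) (P - {W})) = ?m"
      using finP notin[of W] that card_Suc_Diff1[OF finP that] by simp
    then show ?thesis
      unfolding partition_term_def using finP notin[of W] by simp
  qed
  have enlarged_sum: "(\<Sum>W\<in>P. partition_term \<eta> g (insert (insert a W) (P - {W})) y) =
      ?c / g y ^ (?m + 1) * (\<Sum>W\<in>P. ?D (insert a W) y * (\<Prod>V\<in>P - {W}. ?D V y))"
    by (simp add: enlarged sum_distrib_left)
  then show ?thesis
    using DERIV_mult[OF dcoeff dprod]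
    by (simp only: new enlarged_sum partition_term_def[of \<eta> g P] scaleR_zero_left add_0_right
        mult.commute[of "\<Sum>W\<in>P. ?D (insert a W) y * (\<Prod>V\<in>P - {W}. ?D V y)"])
qed

lemma reciprocal_diff_deriv:
  assumes "gateaux_differentiable_upto n g" "\<And>x. g x \<noteq> 0"
    and A: "finite A" "card A < n" "\<forall>b\<in>A. b < a"
  shows "has_line_derivative (reciprocal_diff \<eta> g A) y (\<eta> a) (reciprocal_diff \<eta> g (insert a A) y)"
proof -
  have "a \<notin> A" using A(3) by auto
  then show ?thesis
    unfolding reciprocal_diff_def sum_partition_on_insert[OF A(1) \<open>a \<notin> A\<close>]
    by (intro DERIV_sum partition_term_line_derivative[OF assms]) auto
qed

section \<open>Differentials of the quotient\<close>

definition quotient_diff ::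
    "(nat \<Rightarrow> 'a::real_normed_vector) \<Rightarrow> ('a \<Rightarrow> real) \<Rightarrow> ('a \<Rightarrow> real) \<Rightarrow> nat set \<Rightarrow> 'a \<Rightarrow> real" where
  "quotient_diff \<eta> f g K y =
     (\<Sum>A\<in>Pow K. reciprocal_diff \<eta> g A y * gateaux_diff f y (incr_list \<eta> (K - A)))"

text \<open>The two terms of the product rule for the summand of \<open>A\<close> are the summands of \<open>insert a A\<close>
  and of \<open>A\<close>, now as subsets of \<open>insert a K\<close>.\<close>

lemma quotient_diff_deriv:
  assumes f: "gateaux_differentiable_upto n f"
    and g: "gateaux_differentiable_upto n g" "\<And>x. g x \<noteq> 0"
    and K: "finite K" "card K < n" "\<forall>b\<in>K. b < a"
  shows "has_line_derivative (quotient_diff \<eta> f g K) y (\<eta> a) (quotient_diff \<eta> f g (insert a K) y)"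
proof -
  let ?R = "\<lambda>A x. reciprocal_diff \<eta> g A x"
  let ?D = "\<lambda>B x. gateaux_diff f x (incr_list \<eta> B)"
  have a: "a \<notin> K" using K(3) by auto
  have "has_line_derivative (\<lambda>x. ?R A x * ?D (K - A) x) y (\<eta> a)
      (?R A y * ?D (insert a K - A) y + ?R (insert a A) y * ?D (insert a K - insert a A) y)"
    if "A \<in> Pow K" for A
  proof -
    have AK: "A \<subseteq> K" using that by simp
    then have A: "finite A" "card A < n" "\<forall>b\<in>A. b < a"
      using AK K card_mono[OF K(1) AK] finite_subset[OF AK K(1)] by auto
    have B: "finite (K - A)" "card (K - A) < n" "\<forall>b\<in>K - A. b < a"
      using K card_mono[OF K(1) Diff_subset, of A] by auto
    have eq: "insert a K - A = insert a (K - A)" "insert a K - insert a A = K - A"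
      using a AK by auto
    show ?thesis
      unfolding eq
      using DERIV_mult[OF reciprocal_diff_deriv[OF g A, where \<eta> = \<eta> and y = y]
          gateaux_diff_line_derivative[OF f B, where \<eta> = \<eta> and y = y]]
      by (simp add: algebra_simps)
  qed
  then have "has_line_derivative (quotient_diff \<eta> f g K) y (\<eta> a)
      (\<Sum>A\<in>Pow K. ?R A y * ?D (insert a K - A) y +
         ?R (insert a A) y * ?D (insert a K - insert a A) y)"
    unfolding quotient_diff_def by (rule DERIV_sum)
  also have "(\<Sum>A\<in>Pow K. ?R A y * ?D (insert a K - A) y +
         ?R (insert a A) y * ?D (insert a K - insert a A) y) = quotient_diff \<eta> f g (insert a K) y"
  proof -
    have "inj_on (insert a) (Pow K)"
      using a by (auto intro!: inj_onI)
    moreover have "Pow K \<inter> insert a ` Pow K = {}"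
      using a by auto
    ultimately show ?thesis
      using K(1) unfolding quotient_diff_def Pow_insert
      by (simp add: sum.union_disjoint sum.reindex sum.distrib)
  qed
  finally show ?thesis .
qed

text \<open>The induction is over all points at once, because the differential of the next order sees
  the previous one as a function.\<close>

lemma gateaux_diff_quotient:
  assumes f: "gateaux_differentiable_upto n f"
    and g: "gateaux_differentiable_upto n g" "\<And>x. g x \<noteq> 0"
    and "k \<le> n"
  shows "gateaux_diff (\<lambda>x. f x / g x) y (incr_list \<eta> {1..k}) = quotient_diff \<eta> f g {1..k} y"
  using \<open>k \<le> n\<close>
proof (induction k arbitrary: y)
  case 0
  show ?case
    by (simp add: quotient_diff_def reciprocal_diff_def partition_term_def incr_list_def
        partition_on_empty)
next
  case (Suc k)
  have ins: "{1..Suc k} = insert (Suc k) {1..k}"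
    by auto
  have "(\<lambda>x. gateaux_diff (\<lambda>x. f x / g x) x (incr_list \<eta> {1..k})) = quotient_diff \<eta> f g {1..k}"
    using Suc by (intro ext) simp
  then have "gateaux_diff (\<lambda>x. f x / g x) y (incr_list \<eta> {1..Suc k}) =
      gateaux (quotient_diff \<eta> f g {1..k}) y (\<eta> (Suc k))"
    unfolding ins by (simp add: incr_list_insert_greatest gateaux_diff_snoc)
  also have "\<dots> = quotient_diff \<eta> f g (insert (Suc k) {1..k}) y"
    using Suc.prems by (intro gateaux_eqI quotient_diff_deriv[OF f g]) auto
  finally show ?case
    unfolding ins .
qed

text \<open>Any list of increments arises as \<open>incr_list \<eta> {1..k}\<close>, with \<open>\<eta> (k + 1)\<close> left for the
  next one, so the formula for the differential along that list applies and can be differentiated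
  once more.\<close>

lemma gateaux_differentiable_upto_quotient:
  assumes f: "gateaux_differentiable_upto n f"
    and g: "gateaux_differentiable_upto n g" "\<And>x. g x \<noteq> 0"
  shows "gateaux_differentiable_upto n (\<lambda>x. f x / g x)"
  unfolding gateaux_differentiable_upto_def
proof (intro allI impI)
  fix \<xi>s :: "'a list" and y \<xi> :: 'a
  assume len: "length \<xi>s < n"
  let ?k = "length \<xi>s"
  \<comment> \<open>The indices start at \<open>1\<close>, the positions in the list at \<open>0\<close>.\<close>
  define \<eta> where "\<eta> i = (\<xi>s @ [\<xi>]) ! (i - 1)" for i
  have "sorted_list_of_set {1..?k} = map Suc [0..<?k]"
    using sorted_list_of_set_range[of 1 "Suc ?k"]
    unfolding map_Suc_upt atLeastLessThanSuc_atLeastAtMost One_nat_def .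
  then have list: "incr_list \<eta> {1..?k} = \<xi>s"
    by (auto simp: incr_list_def \<eta>_def nth_append intro!: nth_equalityI)
  have "\<eta> (Suc ?k) = \<xi>"
    by (simp add: \<eta>_def)
  then have "has_gateaux (quotient_diff \<eta> f g {1..?k}) y \<xi>"
    using quotient_diff_deriv[OF f g, where K = "{1..?k}" and a = "Suc ?k" and \<eta> = \<eta> and y = y] len
    by (auto simp: has_gateaux_iff)
  moreover have "(\<lambda>x. gateaux_diff (\<lambda>x. f x / g x) x \<xi>s) = quotient_diff \<eta> f g {1..?k}"
    using gateaux_diff_quotient[OF f g, where k = ?k and \<eta> = \<eta>] len
    unfolding list by (intro ext) simp
  ultimately show "has_gateaux (\<lambda>x. gateaux_diff (\<lambda>x. f x / g x) x \<xi>s) y \<xi>"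
    by simp
qed

theorem theorem1:
  fixes f g :: "'a::banach \<Rightarrow> real" and n :: nat and y :: 'a and \<eta> :: "nat \<Rightarrow> 'a"
  assumes "n \<ge> 1"
    and "gateaux_differentiable_upto n f"
    and "gateaux_differentiable_upto n g"
    and "\<And>x. g x \<noteq> 0"
  shows "gateaux_differentiable_upto n (\<lambda>x. f x / g x) \<and>
    gateaux_diff (\<lambda>x. f x / g x) y (incr_list \<eta> {1..n}) =
      (\<Sum>A\<in>Pow {1..n}.
        (\<Sum>\<pi> | partition_on A \<pi>.
           (-1) ^ card \<pi> * fact (card \<pi>) / g y ^ (card \<pi> + 1) *
           (\<Prod>\<omega>\<in>\<pi>. gateaux_diff g y (incr_list \<eta> \<omega>))) *
        gateaux_diff f y (incr_list \<eta> ({1..n} - A)))"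
  using gateaux_differentiable_upto_quotient[OF assms(2-4)]
    gateaux_diff_quotient[OF assms(2-4) order_refl, where y = y and \<eta> = \<eta>]
  by (simp add: quotient_diff_def reciprocal_diff_def partition_term_def)

end
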